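(* Let $m\in\mathbb{N}$ and $N\in\mathbb{N}$ with $N\ge 2$. For $k\in\mathbb{N}$ let $\mathcal{N}_k(n)$ be the number of $k$-part sum systems generating $0,\dots,n-1$ (all components of cardinality at least $2$), and set $\mathcal{N}_0(n)=\delta_{n,1}$. Then \[ \mathcal{N}_m(N)=\sum_{d\mid N,\ d<N}\big((m-1)\mathcal{N}_m(d)+m\,\mathcal{N}_{m-1}(d)\big)=-m\sum_{d\mid N,\ d<N}\mu\!\left(\frac{N}{d}\right)\big(\mathcal{N}_m(d)+\mathcal{N}_{m-1}(d)\big). \] Moreover, with $\mathcal{M}_k(n)=\frac{1}{k!}\mathcal{N}_k(n)$ for $k\ge 0$, \[ \mathcal{M}_m(N)=\sum_{d\mid N,\ d<N}\big((m-1)\mathcal{M}_m(d)+\mathcal{M}_{m-1}(d)\big)=-\sum_{d\mid N,\ d<N}\mu\!\left(\frac{N}{d}\right)\big(m\,\mathcal{M}_m(d)+\mathcal{M}_{m-1}(d)\big). \]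
   Context: A $k$-part sum system generating $0,\dots,n-1$ is an ordered $k$-tuple of sets $A_1,\dots,A_k\subset\mathbb{N}_0$ with $|A_j|\ge2$, $|A_1|\cdots|A_k|=n$ and $A_1+\dots+A_k=\{0,1,\dots,n-1\}$ (Minkowski sum). Equivalently, $\mathcal{N}_k(n)=\sum_{L\ge0}k!\,S(L,k)\,(e-\mu)^{*L}(n)$ with $S(L,k)$ Stirling numbers of the second kind, $e(n)=\delta_{n,1}$, $\mu$ the Möbius function and $*$ Dirichlet convolution; this formula with $k=0$ gives the convention $\mathcal{N}_0(n)=\delta_{n,1}$. $\mathcal{M}_k(n)$ counts such systems up to permutation of the $k$ parts. *)

theory Defs
  imports
    "HOL-Library.Set_Algebras"
    "HOL-Computational_Algebra.Computational_Algebra"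
    "HOL-Combinatorics.Multiset_Permutations"
begin

text \<open>
  Ordered tuples are lists. The sum of a list of sets is their Minkowski sum, as addition of
  sets is elementwise (\<^theory>\<open>HOL-Library.Set_Algebras\<close>). As \<open>card A = 0\<close> for infinite \<open>A\<close>,
  the condition \<open>2 \<le> card A\<close> also forces the components to be finite.
\<close>

definition sum_systems :: "nat \<Rightarrow> nat \<Rightarrow> nat set list set" where
  "sum_systems k n = {As. length As = k \<and> (\<forall>A\<in>set As. 2 \<le> card A) \<and>
     prod_list (map card As) = n \<and> sum_list As = {0..<n}}"

definition num_sum_systems :: "nat \<Rightarrow> nat \<Rightarrow> nat" where
  "num_sum_systems k n =
     (if k = 0 then (if n = 1 then 1 else 0) else card (sum_systems k n))"

definition num_unordered_sum_systems :: "nat \<Rightarrow> nat \<Rightarrow> rat" where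
  "num_unordered_sum_systems k n = of_nat (num_sum_systems k n) / fact k"

definition moebius :: "nat \<Rightarrow> int" where
  "moebius n = (if squarefree n then (-1) ^ card (prime_factors n) else 0)"


text \<open>
  The next facts confirm the conventions: only finitely many sum systems are counted, the
  convention for \<open>k = 0\<close> agrees with the general count, and division by \<open>fact k\<close> yields the
  number of sum systems up to permutation of their components.
\<close>

lemma sum_list_sets_subset:
  fixes As :: "nat set list"
  assumes "0 \<in> sum_list As" "A \<in> set As"
  shows "A \<subseteq> sum_list As"
proof -
  have "0 \<in> sum_list As \<Longrightarrow> A \<in> set As \<Longrightarrow> A \<subseteq> sum_list As"
  proof (induction As)
    case (Cons B Bs)
    then have "0 \<in> B" "0 \<in> sum_list Bs" by (auto simp: set_plus_def)
    then have "B \<subseteq> B + sum_list Bs" "sum_list Bs \<subseteq> B + sum_list Bs"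
      by (force simp: set_plus_def)+
    with Cons \<open>0 \<in> sum_list Bs\<close> show ?case by auto
  qed simp
  with assms show ?thesis by blast
qed

lemma sum_systems_subset: "sum_systems k n \<subseteq> {As. set As \<subseteq> Pow {0..<n} \<and> length As = k}"
proof (safe, goal_cases)
  case (1 As A x)
  then have "0 < prod_list (map card As)"
    using prod_list_zero_iff[of "map card As"] by (auto simp: sum_systems_def)
  with 1 have "0 \<in> sum_list As" by (auto simp: sum_systems_def)
  with 1 sum_list_sets_subset[of As A] show ?case by (auto simp: sum_systems_def)
qed (auto simp: sum_systems_def)

lemma finite_sum_systems: "finite (sum_systems k n)"
  by (rule finite_subset[OF sum_systems_subset finite_lists_length_eq]) simp

lemma num_sum_systems_eq_card: "num_sum_systems k n = card (sum_systems k n)"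
proof (cases "k = 0")
  case True
  have "sum_systems 0 n = (if n = 1 then {[]} else {})"
    by (auto simp: sum_systems_def)
  with True show ?thesis by (simp add: num_sum_systems_def)
qed (simp add: num_sum_systems_def)

lemma card_sum_list_le:
  fixes As :: "nat set list"
  assumes "\<forall>A\<in>set As. finite A"
  shows "finite (sum_list As) \<and> card (sum_list As) \<le> prod_list (map card As)"
  using assms
proof (induction As)
  case (Cons A As)
  have "A + sum_list As = (\<lambda>(a, b). a + b) ` (A \<times> sum_list As)"
    by (auto simp: set_plus_def)
  with Cons card_image_le[of "A \<times> sum_list As" "\<lambda>(a, b). a + b"] show ?case
    by (auto simp: card_cartesian_product intro: order.trans)
qed simp

lemma sum_system_distinct:
  assumes "As \<in> sum_systems k n"
  shows "distinct As"
proof (rule ccontr)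
  assume "\<not> distinct As"
  then obtain xs ys zs A where As: "As = xs @ [A] @ ys @ [A] @ zs"
    using not_distinct_decomp by blast
  define R where "R = sum_list (xs @ ys @ zs)"
  have card2: "2 \<le> card B" if "B \<in> set As" for B
    using assms that by (auto simp: sum_systems_def)
  have fin: "finite B" if "B \<in> set As" for B
    using card2[OF that] by (metis card.infinite not_numeral_le_zero)
  have A: "finite A" "2 \<le> card A" using card2 fin by (auto simp: As)
  then obtain a b where ab: "a \<in> A" "b \<in> A" "a \<noteq> b"
    by (metis card_le_Suc0_iff_eq not_less_eq_eq numeral_2_eq_2)
  have R: "finite R" "card R \<le> prod_list (map card (xs @ ys @ zs))"
    using card_sum_list_le[of "xs @ ys @ zs"] fin by (auto simp: R_def As)
  have "A + A \<subseteq> (\<lambda>(x, y). x + y) ` (A \<times> A - {(a, b)})"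
  proof
    fix c assume "c \<in> A + A"
    then obtain x y where xy: "c = x + y" "x \<in> A" "y \<in> A" by (auto simp: set_plus_def)
    show "c \<in> (\<lambda>(x, y). x + y) ` (A \<times> A - {(a, b)})"
    proof (cases "(x, y) = (a, b)")
      case True
      with xy ab show ?thesis by (intro image_eqI[of _ _ "(b, a)"]) auto
    next
      case False
      with xy show ?thesis by (intro image_eqI[of _ _ "(x, y)"]) auto
    qed
  qed
  then have "card (A + A) \<le> card (A \<times> A - {(a, b)})"
    using A by (intro surj_card_le) auto
  also have "\<dots> < card (A \<times> A)" using A ab by (intro card_Diff1_less) auto
  finally have AA: "card (A + A) < card A * card A" by (simp add: card_cartesian_product)
  have "sum_list As = (A + A) + R"
    by (simp add: As R_def ac_simps)
  also have "card \<dots> \<le> card (A + A) * card R"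
    using card_sum_list_le[of "[A + A, R]"] A R by (simp add: finite_set_plus)
  also have "\<dots> \<le> card (A + A) * prod_list (map card (xs @ ys @ zs))"
    using R by simp
  also have "\<dots> < card A * card A * prod_list (map card (xs @ ys @ zs))"
  proof -
    have "0 < prod_list (map card (xs @ ys @ zs))"
      using card2 prod_list_zero_iff[of "map card (xs @ ys @ zs)"] by (fastforce simp: As)
    with AA show ?thesis by simp
  qed
  also have "\<dots> = prod_list (map card As)" by (simp add: As ac_simps)
  finally show False using assms by (auto simp: sum_systems_def)
qed

lemma num_unordered_sum_systems_eq_card:
  "num_unordered_sum_systems k n = of_nat (card (mset ` sum_systems k n))"
proof -
  have fib: "{As \<in> sum_systems k n. mset As = mset Bs} = permutations_of_multiset (mset Bs)"
    if "Bs \<in> sum_systems k n" for Bs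
  proof -
    have "As \<in> sum_systems k n" if "mset As = mset Bs" for As
    proof -
      have "prod_list (map card As) = prod_list (map card Bs)" "sum_list As = sum_list Bs"
           "set As = set Bs" "length As = length Bs"
        using that by (metis mset_map prod_mset_prod_list, metis sum_mset_sum_list,
            metis set_mset_mset, metis size_mset)
      with \<open>Bs \<in> _\<close> show ?thesis by (simp add: sum_systems_def)
    qed
    then show ?thesis by (auto simp: permutations_of_multiset_def)
  qed
  have "card {As \<in> sum_systems k n. mset As = M} = fact k" if M: "M \<in> mset ` sum_systems k n" for M
  proof -
    obtain Bs where Bs: "Bs \<in> sum_systems k n" "M = mset Bs" using M by auto
    have "M = mset_set (set Bs)" "card (set Bs) = k"
      using sum_system_distinct[OF Bs(1)] Bs
      by (auto simp: mset_set_set distinct_card sum_systems_def)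
    then show ?thesis using fib[OF Bs(1)] Bs
      by (metis card_permutations_of_set List.finite_set permutations_of_set_altdef)
  qed
  then have "card (sum_systems k n) = fact k * card (mset ` sum_systems k n)"
    using sum.image_gen[OF finite_sum_systems, of "\<lambda>_. 1::nat" k n mset] by simp
  then show ?thesis
    by (simp add: num_unordered_sum_systems_def num_sum_systems_eq_card)
qed

end

theory Submission
  imports Defs
begin

text \<open>
  Let \<open>c(n)\<close> count the systems \<open>(A, R\<^sub>1, \<dots>, R\<^sub>k)\<close> for \<open>n\<close> with \<open>1 \<in> A\<close>. Exactly one component
  of a system contains \<open>1\<close> (if \<open>n \<ge> 2\<close>), and rotating it to the front shows
  \<open>N\<^sub>k\<^sub>+\<^sub>1(n) = (k + 1) c(n)\<close>. If \<open>f\<close> is the least number not in \<open>A\<close>, then de Bruijn's argument on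
  blocks of length \<open>f\<close> gives \<open>A = {x. x div f \<in> B}\<close> and \<open>R\<^sub>i = f C\<^sub>i\<close>, where the sets \<open>B, C\<^sub>1, \<dots>, C\<^sub>k\<close>
  form a system for \<open>d = n / f\<close>, except that \<open>B\<close> may be \<open>{0}\<close>, and \<open>1 \<notin> B\<close>. This is a
  bijection, so \<open>c(n)\<close> is the sum of \<open>N\<^sub>k\<^sub>+\<^sub>1(d) - c(d) + N\<^sub>k(d)\<close> over the proper divisors \<open>d\<close>
  of \<open>n\<close>; multiplied by \<open>k + 1\<close> this is the first recursion. Adding \<open>N\<^sub>k\<^sub>+\<^sub>1(n)\<close> to the sum turns it
  into an identity between divisor sums, and Moebius inversion yields the second one.
\<close>

section \<open>Tilings of an initial interval by two summands\<close>

text \<open>Addition maps \<open>A \<times> sum_list Rs\<close>, which has at most \<open>n\<close>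
  elements, onto the \<open>n\<close> elements of \<open>{0..<n}\<close>; counting forces
  injectivity.\<close>

lemma sum_system_Cons_inj_on:
  assumes "A # Rs \<in> sum_systems k n" "0 < n"
  shows "inj_on (\<lambda>(a, r). a + r) (A \<times> sum_list Rs)"
proof (rule eq_card_imp_inj_on)
  let ?R = "sum_list Rs"
  have sys: "\<forall>B\<in>set (A # Rs). 2 \<le> card B" "card A * prod_list (map card Rs) = n" "A + ?R = {0..<n}"
    using assms(1) by (auto simp: sum_systems_def)
  have fin: "\<forall>B\<in>set (A # Rs). finite B"
    using sys(1) by (metis card.infinite not_numeral_le_zero)
  then have R: "finite ?R" "card ?R \<le> prod_list (map card Rs)"
    using card_sum_list_le[of Rs] by auto
  have "n \<le> card A * card ?R"
    using card_sum_list_le[of "[A, ?R]"] R fin sys(3) by simp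
  moreover have "card A * card ?R \<le> n" using R sys(2) by auto
  moreover have "(\<lambda>(a, r). a + r) ` (A \<times> ?R) = A + ?R" by (auto simp: set_plus_def)
  ultimately show "card ((\<lambda>(a, r). a + r) ` (A \<times> ?R)) = card (A \<times> ?R)"
    using sys(3) by (simp add: card_cartesian_product)
  show "finite (A \<times> ?R)" using fin R by simp
qed

text \<open>De Bruijn's argument, by strong induction on the block number \<open>t\<close>. The
  lower blocks are settled, and the splitting \<open>t * f = a + r\<close> decides the next one: if
  both summands are smaller, it is the translate by \<open>r\<close> of a lower block of
  \<open>A\<close>; if \<open>r = t * f\<close>, it is the translate of \<open>{0..<f}\<close> by
  \<open>r\<close>; only for \<open>a = t * f\<close> does it belong to \<open>A\<close>.\<close>

lemma tiling_block:
  fixes A R :: "nat set"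
  assumes sum: "A + R = {0..<n}" and inj: "inj_on (\<lambda>(a, r). a + r) (A \<times> R)"
    and f: "f \<notin> A" "\<And>x. x < f \<Longrightarrow> x \<in> A" and "t * f < n"
  shows "t * f + f \<le> n \<and> ((\<forall>i<f. t * f + i \<in> A) \<or> (\<forall>i<f. t * f + i \<notin> A)) \<and>
    (\<forall>i<f. 0 < i \<longrightarrow> t * f + i \<notin> R)"
  using \<open>t * f < n\<close>
proof (induction t rule: less_induct)
  case (less t)
  have "0 \<in> A + R" using less.prems by (simp add: sum)
  then have 0: "0 \<in> A" "0 \<in> R" by (auto simp: set_plus_def)
  then have "0 < f" using f by (metis gr0I)
  have lt: "a + r < n" if "a \<in> A" "r \<in> R" for a r
    using that sum by (metis atLeastLessThan_iff set_plus_intro)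
  have uniq: "a = a' \<and> r = r'" if "a \<in> A" "r \<in> R" "a' \<in> A" "r' \<in> R" "a + r = a' + r'" for a r a' r'
    using inj_onD[OF inj, of "(a, r)" "(a', r')"] that by auto
  have ex: "\<exists>a\<in>A. \<exists>r\<in>R. x = a + r" if "x < n" for x
    using that sum by (metis atLeastLessThan_iff le0 set_plus_elim)
  \<comment> \<open>Such an \<open>r\<close> also lies in \<open>A\<close>, so \<open>r + 0\<close>
    and \<open>0 + r\<close> are two splittings of \<open>r\<close>.\<close>
  have small: "r = 0" if "r \<in> R" "r < f" for r
    using uniq[of r 0 0 r] that f 0 by auto
  have "f \<le> n" using lt[of "f - 1" 0] f(2)[of "f - 1"] 0 \<open>0 < f\<close> by simp
  have fR: "f \<in> R" if "f < n"
  proof -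
    obtain a r where "a \<in> A" "r \<in> R" "f = a + r" using ex[OF \<open>f < n\<close>] by blast
    with small[of r] f(1) show ?thesis by (cases "r < f") auto
  qed
  show ?case
  proof (cases "t = 0")
    case True
    then show ?thesis using \<open>f \<le> n\<close> f(2) small by auto
  next
    case False
    then have "f \<le> t * f" by simp
    have lower_A: "x div f * f + i \<in> A" if "x \<in> A" "x < t * f" "i < f" for x i
    proof -
      have "x div f < t" using that by (simp add: less_mult_imp_div_less)
      moreover have "x div f * f < n"
        using \<open>x < t * f\<close> less.prems by (meson div_times_less_eq_dividend le_less_trans less_trans)
      moreover have "x div f * f + x mod f \<in> A" "x mod f < f" using that by auto
      ultimately show ?thesis using less.IH \<open>i < f\<close> by blast
    qed
    have lower_R: "f dvd x" if "x \<in> R" "x < t * f" for x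
    proof -
      have "x div f < t" using that by (simp add: less_mult_imp_div_less)
      moreover have "x div f * f < n"
        using \<open>x < t * f\<close> less.prems by (meson div_times_less_eq_dividend le_less_trans less_trans)
      moreover have "x div f * f + x mod f \<in> R" "x mod f < f" using that \<open>0 < f\<close> by auto
      ultimately show ?thesis using less.IH by (metis gr0I mod_eq_0_iff_dvd)
    qed
    obtain a r where ar: "a \<in> A" "r \<in> R" "t * f = a + r" using ex[OF less.prems] by blast
    consider "a < t * f" "r < t * f" | "a = 0" "r = t * f" | "a = t * f" "r = 0"
      using ar by linarith
    then show ?thesis
    proof cases
      case 1
      have "f dvd a" using lower_R[of r] ar 1 by (metis dvd_add_left_iff dvd_triv_right)
      then have shift: "a + i \<in> A" if "i < f" for i
        using lower_A[of a i] ar 1 that by simp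
      have "t * f + i \<notin> A" if "i < f" for i
        using uniq[of "t * f + i" 0 "a + i" r] shift[OF that] ar 0 1 by auto
      moreover have "t * f + i \<notin> R" if "i < f" for i
        using uniq[of 0 "t * f + i" "a + i" r] shift[OF that] ar 0 1 by auto
      moreover have "t * f + f \<le> n"
        using lt[of "a + (f - 1)" r] shift[of "f - 1"] ar \<open>0 < f\<close> by simp
      ultimately show ?thesis by blast
    next
      case 2
      then have "t * f \<in> R" using ar by simp
      have "t * f + i \<notin> A" if "i < f" for i
        using uniq[of "t * f + i" 0 i "t * f"] f(2)[OF that] \<open>t * f \<in> R\<close> 0 \<open>0 < f\<close> False by auto
      moreover have "t * f + i \<notin> R" if "i < f" "0 < i" for i
        using uniq[of 0 "t * f + i" i "t * f"] f(2)[OF that(1)] \<open>t * f \<in> R\<close> 0 that by auto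
      moreover have "t * f + f \<le> n"
        using lt[of "f - 1" "t * f"] f(2)[of "f - 1"] \<open>t * f \<in> R\<close> \<open>0 < f\<close> by simp
      ultimately show ?thesis by blast
    next
      case 3
      then have "t * f \<in> A" using ar by simp
      have "f < n" using less.prems \<open>f \<le> t * f\<close> by linarith
      then have "f \<in> R" by (rule fR)
      \<comment> \<open>For \<open>i > 0\<close>, \<open>(f - i) + (t * f + i)\<close> would be a
        second splitting of \<open>t * f + f\<close>, besides the one with \<open>f\<close> taken
        from \<open>R\<close>.\<close>
      have nR: "t * f + i \<notin> R" if "i < f" for i
      proof (cases "i = 0")
        case True
        then show ?thesis using uniq[of 0 "t * f" "t * f" 0] \<open>t * f \<in> A\<close> 0 \<open>0 < f\<close> False by auto
      next
        case i: False
        then show ?thesis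
          using uniq[of "f - i" "t * f + i" "t * f" f] f(2)[of "f - i"] \<open>t * f \<in> A\<close> that \<open>f \<in> R\<close> \<open>f \<le> t * f\<close>
          by auto
      qed
      have "t * f + f < n" using lt[of "t * f" f] \<open>t * f \<in> A\<close> \<open>f \<in> R\<close> by simp
      moreover have "t * f + i \<in> A" if "i < f" for i
      proof -
        have "t * f + i < n" using \<open>t * f + f < n\<close> that by simp
        then obtain b s where bs: "b \<in> A" "s \<in> R" "t * f + i = b + s"
          using ex by blast
        have "s < t * f"
        proof (rule ccontr)
          assume "\<not> s < t * f"
          then have "s = t * f + (s - t * f)" "s - t * f < f" using bs that by auto
          then show False using nR bs by metis
        qed
        \<comment> \<open>Otherwise \<open>b\<close> can be moved down to the start of its block. As
          \<open>f\<close> divides \<open>s\<close>, this gives a splitting of \<open>t * f\<close>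
          other than \<open>t * f + 0\<close>.\<close>
        have "\<not> b < t * f"
        proof
          assume "b < t * f"
          then have b: "b div f * f \<in> A" using lower_A[of b 0] bs \<open>0 < f\<close> by simp
          obtain q where q: "s = f * q" using lower_R[of s] bs \<open>s < t * f\<close> by auto
          have "t = (t * f + i) div f" using that by simp
          also have "\<dots> = b div f + q" using bs q \<open>0 < f\<close> by simp
          finally have "b div f * f + s = t * f + 0" using q by (simp add: algebra_simps)
          then have "b div f * f = t * f" using uniq[of "b div f * f" s "t * f" 0] b bs \<open>t * f \<in> A\<close> 0 by simp
          then show False using \<open>b < t * f\<close> by (metis div_times_less_eq_dividend leD)
        qed
        then have "s = 0" using small[of s] bs that by simp
        then show ?thesis using bs by simp
      qed
      ultimately show ?thesis using nR by auto
    qed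
  qed
qed

section \<open>Inflation by blocks of length \<open>f\<close>\<close>

definition inflate :: "nat \<Rightarrow> nat set list \<Rightarrow> nat set list" where
  "inflate f Bs = {x. x div f \<in> hd Bs} # map ((`) ((*) f)) (tl Bs)"

lemma card_div_vimage:
  assumes "0 < f"
  shows "card {x::nat. x div f \<in> B} = f * card B"
proof -
  have "bij_betw (\<lambda>(b, i). b * f + i) (B \<times> {0..<f}) {x. x div f \<in> B}"
    by (rule bij_betw_byWitness[where f' = "\<lambda>x. (x div f, x mod f)"]) (use assms in auto)
  then show ?thesis by (simp add: bij_betw_same_card[symmetric] card_cartesian_product)
qed

text \<open>Adding \<open>f * c\<close> raises the quotient by \<open>c\<close> and keeps the
  remainder. Conversely, the remainder of \<open>x\<close> is given to the first summand.\<close>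

lemma div_vimage_plus:
  assumes "0 < f"
  shows "{x::nat. x div f \<in> B} + (*) f ` C = {x. x div f \<in> B + C}"
proof (rule set_eqI, rule iffI)
  fix x assume "x \<in> {x. x div f \<in> B} + (*) f ` C"
  then show "x \<in> {x. x div f \<in> B + C}"
    using assms by (auto simp: set_plus_def) (metis add.commute)
next
  fix x assume "x \<in> {x. x div f \<in> B + C}"
  then obtain b c where bc: "b \<in> B" "c \<in> C" "x div f = b + c" by (auto simp: set_plus_def)
  have "x = (b * f + x mod f) + f * c"
    using bc by (metis add.assoc add.commute add_mult_distrib div_mult_mod_eq mult.commute)
  moreover have "(b * f + x mod f) div f = b" using assms by simp
  ultimately show "x \<in> {x. x div f \<in> B} + (*) f ` C"
    using bc by (metis (mono_tags, lifting) image_eqI mem_Collect_eq set_plus_intro)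
qed

lemma sum_list_image_mult:
  fixes f :: nat
  shows "sum_list (map ((`) ((*) f)) Cs) = (*) f ` sum_list Cs"
proof (induction Cs)
  case (Cons C Cs)
  have "(*) f ` C + (*) f ` X = (*) f ` (C + X)" for X
    by (force simp: set_plus_def algebra_simps)
  with Cons show ?case by simp
qed simp

lemma sum_list_inflate:
  assumes "0 < f" "Bs \<noteq> []"
  shows "sum_list (inflate f Bs) = {x. x div f \<in> sum_list Bs}"
  using assms by (cases Bs) (auto simp: inflate_def sum_list_image_mult div_vimage_plus)

lemma card_image_mult: "0 < (f::nat) \<Longrightarrow> card ((*) f ` C) = card C"
  by (rule card_image) (simp add: inj_on_def)

lemma prod_card_inflate:
  assumes "0 < f" "Bs \<noteq> []"
  shows "prod_list (map card (inflate f Bs)) = f * prod_list (map card Bs)"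
proof -
  have "map card (map ((`) ((*) f)) Cs) = map card Cs" for Cs
    using assms by (simp add: card_image_mult)
  then show ?thesis
    using assms by (cases Bs) (simp_all add: inflate_def card_div_vimage del: map_map)
qed

text \<open>The multiples of \<open>f\<close> in the inflated head recover the head; the tail is
  recovered because dilation by \<open>f > 0\<close> is injective on sets.\<close>

lemma inj_inflate:
  assumes "0 < f" "Bs \<noteq> []" "Bs' \<noteq> []" "inflate f Bs = inflate f Bs'"
  shows "Bs = Bs'"
proof -
  have "hd Bs = hd Bs'"
  proof (rule set_eqI)
    fix b
    have "b * f \<in> {x. x div f \<in> hd Bs} \<longleftrightarrow> b * f \<in> {x. x div f \<in> hd Bs'}"
      using assms by (simp add: inflate_def)
    then show "b \<in> hd Bs \<longleftrightarrow> b \<in> hd Bs'" using assms by simp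
  qed
  moreover have "inj ((`) ((*) f))" using assms by (simp add: inj_on_def inj_image_eq_iff)
  then have "tl Bs = tl Bs'" using assms by (auto simp: inflate_def dest: map_injective)
  ultimately show ?thesis using assms by (metis list.collapse)
qed

section \<open>Cores, rooted systems and the bijection between them\<close>

text \<open>The second part of \<open>cores k n\<close> accounts for a first component that inflates to a single
  initial block \<open>{0..<f}\<close>.\<close>

definition cores :: "nat \<Rightarrow> nat \<Rightarrow> nat set list set" where
  "cores k n = {Bs \<in> sum_systems (Suc k) n. 1 \<notin> hd Bs} \<union> (#) {0} ` sum_systems k n"

text \<open>Its cardinality is the \<open>c(n)\<close> of the overview, for \<open>n > 0\<close>.
  Having \<open>1\<close> in the head makes the initial block at least \<open>2\<close> long, so
  that the divisor left after removing the block length is proper.\<close>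

definition rooted :: "nat \<Rightarrow> nat \<Rightarrow> nat set list set" where
  "rooted k n = {As \<in> sum_systems (Suc k) n. 1 \<in> hd As}"

text \<open>Dropping the lower bound for the head merges the two kinds of cores: a positive product
  keeps the head nonempty and the sum puts \<open>0\<close> into it, so a head with fewer than two
  elements is \<open>{0}\<close>.\<close>

lemma cores_iff:
  assumes "0 < n"
  shows "Bs \<in> cores k n \<longleftrightarrow> length Bs = Suc k \<and> 1 \<notin> hd Bs \<and> (\<forall>B\<in>set (tl Bs). 2 \<le> card B) \<and>
     prod_list (map card Bs) = n \<and> sum_list Bs = {0..<n}" (is "_ \<longleftrightarrow> ?rhs")
proof
  assume "Bs \<in> cores k n"
  then consider "Bs \<in> sum_systems (Suc k) n" "1 \<notin> hd Bs"
    | Cs where "Bs = {0} # Cs" "Cs \<in> sum_systems k n"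
    by (auto simp: cores_def)
  then show ?rhs
  proof cases
    case 1
    then show ?thesis by (cases Bs) (auto simp: sum_systems_def)
  next
    case 2
    then show ?thesis by (simp add: sum_systems_def)
  qed
next
  assume r: ?rhs
  then obtain B Cs where Bs: "Bs = B # Cs" by (cases Bs) auto
  have "0 \<in> sum_list Bs" using r assms by simp
  then have "0 \<in> B" by (auto simp: Bs set_plus_def)
  show "Bs \<in> cores k n"
  proof (cases "2 \<le> card B")
    case True
    then show ?thesis using r by (auto simp: cores_def sum_systems_def Bs)
  next
    case False
    moreover have "card B \<noteq> 0" using r assms by (auto simp: Bs)
    ultimately have "card B = 1" by linarith
    then have "B = {0}" using \<open>0 \<in> B\<close> by (auto simp: card_1_singleton_iff)
    then have "Cs \<in> sum_systems k n"
      using r by (auto simp: Bs sum_systems_def)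
    then show ?thesis by (simp add: cores_def Bs \<open>B = {0}\<close>)
  qed
qed

text \<open>The block length can be read off an inflated core: \<open>0\<close> in the old head
  gives the full block below \<open>f\<close>, and \<open>1\<close> outside it leaves out
  \<open>f\<close>, which has quotient \<open>1\<close>.\<close>

lemma hd_inflate_Least:
  assumes "Bs \<in> cores k d" "0 < d" "0 < f"
  shows "(LEAST x. x \<notin> hd (inflate f Bs)) = f"
proof (rule Least_equality)
  have Bs: "length Bs = Suc k" "1 \<notin> hd Bs" "sum_list Bs = {0..<d}"
    using assms by (auto simp: cores_iff)
  then show "f \<notin> hd (inflate f Bs)" using assms by (simp add: inflate_def)
  have "0 \<in> sum_list Bs" using Bs assms by simp
  then have "0 \<in> hd Bs" using Bs(1) by (cases Bs) (auto simp: set_plus_def)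
  then show "f \<le> x" if "x \<notin> hd (inflate f Bs)" for x
    using that by (cases "x < f") (auto simp: inflate_def)
qed

text \<open>By \<open>2 \<le> f\<close>, both \<open>0\<close> and \<open>1\<close> have quotient
  \<open>0\<close>, so \<open>1\<close> enters the head, and even a head \<open>{0}\<close> grows to
  at least two elements.\<close>

lemma inflate_cores:
  assumes "Bs \<in> cores k d" "0 < d" "2 \<le> f"
  shows "inflate f Bs \<in> rooted k (f * d)"
proof -
  have Bs: "length Bs = Suc k" "\<forall>B\<in>set (tl Bs). 2 \<le> card B"
    "prod_list (map card Bs) = d" "sum_list Bs = {0..<d}"
    using assms by (auto simp: cores_iff)
  then have "Bs \<noteq> []" by auto
  have "0 \<in> sum_list Bs" using Bs assms by simp
  then have 0: "0 \<in> hd Bs" using \<open>Bs \<noteq> []\<close> by (cases Bs) (auto simp: set_plus_def)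
  have "card (hd Bs) \<noteq> 0" using Bs assms \<open>Bs \<noteq> []\<close> by (cases Bs) auto
  then have "2 \<le> f * card (hd Bs)"
    using assms by (metis One_nat_def Suc_leI gr0I mult.right_neutral mult_le_mono order_trans)
  moreover have "sum_list (inflate f Bs) = {0..<f * d}"
    using Bs assms \<open>Bs \<noteq> []\<close>
    by (auto simp: sum_list_inflate less_mult_imp_div_less mult.commute div_less_iff_less_mult)
  moreover have "prod_list (map card (inflate f Bs)) = f * d"
    using Bs assms \<open>Bs \<noteq> []\<close> by (simp add: prod_card_inflate)
  ultimately show ?thesis
    using Bs assms 0
    by (auto simp: rooted_def sum_systems_def inflate_def card_div_vimage card_image_mult)
qed

text \<open>Surjectivity of inflation: \<open>tiling_block\<close> makes the head a union of full
  blocks and confines all other components to multiples of \<open>f\<close>.\<close>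

lemma rooted_imp_inflate:
  assumes As: "As \<in> rooted k n" and "0 < n"
  obtains f d Bs where "n = f * d" "2 \<le> f" "0 < d" "Bs \<in> cores k d" "As = inflate f Bs"
proof -
  obtain A Rs where AR: "As = A # Rs"
    using As by (cases As) (auto simp: rooted_def sum_systems_def)
  define R where "R = sum_list Rs"
  have sys: "1 \<in> A" "length Rs = k" "\<forall>B\<in>set As. 2 \<le> card B" "card A * prod_list (map card Rs) = n"
     "A + R = {0..<n}"
    using As by (auto simp: AR rooted_def sum_systems_def R_def)
  have fin: "\<forall>B\<in>set As. finite B"
    using sys(3) by (metis card.infinite not_numeral_le_zero)
  then have "finite A" by (simp add: AR)
  have inj: "inj_on (\<lambda>(a, r). a + r) (A \<times> R)"
    using As \<open>0 < n\<close> sum_system_Cons_inj_on by (auto simp: AR R_def rooted_def)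
  \<comment> \<open>By \<open>hd_inflate_Least\<close>, the first gap of the head is the only
    possible block length.\<close>
  define f where "f = (LEAST x. x \<notin> A)"
  have fA: "f \<notin> A"
    unfolding f_def using \<open>finite A\<close> by (metis LeastI_ex ex_new_if_finite infinite_UNIV_nat)
  have below: "x \<in> A" if "x < f" for x using not_less_Least that by (auto simp: f_def)
  have "0 \<in> A + R" using \<open>0 < n\<close> sys by simp
  then have 0: "0 \<in> A" "0 \<in> R" by (auto simp: set_plus_def)
  have "2 \<le> f"
  proof (rule ccontr)
    assume "\<not> 2 \<le> f"
    then have "f = 0 \<or> f = 1" by linarith
    then show False using fA 0 sys(1) by auto
  qed
  have An: "x < n" if "x \<in> A" for x
    using that 0 sys(5) set_plus_intro[of x A 0 R] by simp
  have Rn: "x < n" if "x \<in> R" for x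
    using that 0 sys(5) set_plus_intro[of 0 A x R] by simp
  note block = tiling_block[OF sys(5) inj fA below]
  have A_block: "y \<in> A" if "x \<in> A" "y div f = x div f" for x y
  proof -
    have "x div f * f < n" using An[OF that(1)] by (meson div_times_less_eq_dividend le_less_trans)
    moreover have "x div f * f + x mod f \<in> A" using that by simp
    moreover have "x mod f < f" "y mod f < f" using \<open>2 \<le> f\<close> by auto
    ultimately have "x div f * f + y mod f \<in> A" using block[of "x div f"] by blast
    then show ?thesis using that by (metis div_mult_mod_eq)
  qed
  have R_dvd: "f dvd x" if "x \<in> R" for x
  proof -
    have "x div f * f < n" using Rn[OF that] by (meson div_times_less_eq_dividend le_less_trans)
    moreover have "x div f * f + x mod f \<in> R" using that by simp
    moreover have "x mod f < f" using \<open>2 \<le> f\<close> by auto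
    ultimately show ?thesis using block[of "x div f"] by (metis gr0I mod_eq_0_iff_dvd)
  qed
  \<comment> \<open>A positive remainder would leave a block that starts below \<open>n\<close> and
    ends beyond it.\<close>
  have "f dvd n"
  proof -
    have "\<not> 0 < n mod f"
    proof
      assume "0 < n mod f"
      then have "n div f * f < n" by (metis div_mult_mod_eq less_add_same_cancel1)
      then have "n div f * f + f \<le> n" using block by blast
      moreover have "n mod f < f" using \<open>2 \<le> f\<close> by simp
      ultimately show False by (metis div_mult_mod_eq nat_add_left_cancel_le leD)
    qed
    then show ?thesis by (simp add: mod_eq_0_iff_dvd)
  qed
  then obtain d where d: "n = f * d" by blast
  have "0 < d" using d \<open>0 < n\<close> by simp
  \<comment> \<open>Division by \<open>f\<close> undoes both halves of \<open>inflate\<close>: it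
    collapses full blocks in the head and reverses the dilation in the tail.\<close>
  define Bs where "Bs = map ((`) (\<lambda>x. x div f)) As"
  have "A = {x. x div f \<in> (\<lambda>x. x div f) ` A}"
    using A_block by fastforce
  moreover have "(*) f ` (\<lambda>x. x div f) ` C = C" if "C \<in> set Rs" for C
  proof -
    have "C \<subseteq> R" using sum_list_sets_subset[of Rs C] that 0 by (simp add: R_def)
    then have "f * (x div f) = x" if "x \<in> C" for x using R_dvd that by auto
    then show ?thesis by (simp add: image_image)
  qed
  then have "map ((`) ((*) f)) (map ((`) (\<lambda>x. x div f)) Rs) = Rs"
    by (simp add: map_idI)
  ultimately have infl: "As = inflate f Bs" by (simp add: inflate_def Bs_def AR)
  have "Bs \<noteq> []" "0 < f" using \<open>2 \<le> f\<close> by (auto simp: Bs_def AR)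
  have "Bs \<in> cores k d"
    unfolding cores_iff[OF \<open>0 < d\<close>]
  proof (intro conjI)
    show "length Bs = Suc k" using sys by (simp add: Bs_def AR)
    have "{x. x div f \<in> hd Bs} = A" using infl by (simp add: inflate_def AR)
    then show "1 \<notin> hd Bs" using fA \<open>0 < f\<close> by auto
    show "\<forall>B\<in>set (tl Bs). 2 \<le> card B"
    proof
      fix B assume "B \<in> set (tl Bs)"
      then have "(*) f ` B \<in> set As" by (simp add: infl inflate_def)
      then show "2 \<le> card B" using sys(3) card_image_mult[OF \<open>0 < f\<close>, of B] by auto
    qed
    have "f * prod_list (map card Bs) = prod_list (map card As)"
      unfolding infl by (rule prod_card_inflate[OF \<open>0 < f\<close> \<open>Bs \<noteq> []\<close>, symmetric])
    also have "\<dots> = f * d" using sys(4) d by (simp add: AR)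
    finally have "f * prod_list (map card Bs) = f * d" .
    then show "prod_list (map card Bs) = d" using \<open>0 < f\<close> by simp
    have *: "{x. x div f \<in> sum_list Bs} = {0..<n}"
      using sum_list_inflate[OF \<open>0 < f\<close> \<open>Bs \<noteq> []\<close>] sys(5) by (simp add: AR R_def flip: infl)
    have "y \<in> sum_list Bs \<longleftrightarrow> y < d" for y
    proof -
      have "y \<in> sum_list Bs \<longleftrightarrow> f * y \<in> {x. x div f \<in> sum_list Bs}" using \<open>0 < f\<close> by simp
      then show ?thesis unfolding * using \<open>0 < f\<close> by (simp add: d)
    qed
    then show "sum_list Bs = {0..<d}" by (simp add: set_eq_iff)
  qed
  then show thesis by (rule that[OF d \<open>2 \<le> f\<close> \<open>0 < d\<close> _ infl])
qed

section \<open>Counting rooted systems and cores\<close>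

lemma finite_cores: "finite (cores k n)"
  by (simp add: cores_def finite_sum_systems)

text \<open>Inflating a core for \<open>d\<close> with block length \<open>n div d\<close> is a
  bijection from the disjoint union of the cores over all proper divisors. The least gap of the head
  tells different \<open>d\<close> apart.\<close>

lemma card_rooted:
  assumes "0 < n"
  shows "card (rooted k n) = (\<Sum>d | d dvd n \<and> d < n. card (cores k d))"
proof -
  let ?D = "{d. d dvd n \<and> d < n}"
  let ?g = "\<lambda>(d, Bs). inflate (n div d) Bs"
  have D: "0 < d" "0 < n div d" "2 \<le> n div d" "n div d * d = n" if "d \<in> ?D" for d
  proof -
    have "d dvd n" "d < n" using that by auto
    then obtain c where c: "n = d * c" "d < n" by (elim dvdE)
    then have "c \<noteq> 0" "c \<noteq> 1" using assms by auto
    with c assms show "0 < d" "0 < n div d" "2 \<le> n div d" "n div d * d = n" by auto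
  qed
  have ne: "Bs \<noteq> []" if "Bs \<in> cores k d" for d Bs
    using that by (auto simp: cores_def sum_systems_def)
  have "inj_on ?g (Sigma ?D (cores k))"
  proof (rule inj_onI, clarify)
    fix d Bs d' Bs'
    assume dd: "d dvd n" "d < n" "d' dvd n" "d' < n" and B: "Bs \<in> cores k d" "Bs' \<in> cores k d'"
      and eq: "inflate (n div d) Bs = inflate (n div d') Bs'"
    have "n div d = n div d'"
      using hd_inflate_Least[OF B(1), of "n div d"] hd_inflate_Least[OF B(2), of "n div d'"]
        D[of d] D[of d'] dd eq by simp
    moreover from this have "d = d'" using D[of d] D[of d'] dd
      by (metis (mono_tags, lifting) mem_Collect_eq mult_cancel1 not_less_zero)
    ultimately show "d = d' \<and> Bs = Bs'"
      using inj_inflate[of "n div d" Bs Bs'] ne B eq D[of d] dd by simp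
  qed
  moreover have "?g ` Sigma ?D (cores k) = rooted k n"
  proof (intro equalityI subsetI)
    fix As assume "As \<in> ?g ` Sigma ?D (cores k)"
    then obtain d Bs where "d \<in> ?D" "Bs \<in> cores k d" "As = inflate (n div d) Bs" by auto
    then show "As \<in> rooted k n" using inflate_cores[of Bs k d "n div d"] D[of d] by simp
  next
    fix As assume "As \<in> rooted k n"
    then obtain f d Bs where "n = f * d" "2 \<le> f" "0 < d" "Bs \<in> cores k d" "As = inflate f Bs"
      using rooted_imp_inflate assms by metis
    then show "As \<in> ?g ` Sigma ?D (cores k)" by (intro image_eqI[of _ _ "(d, Bs)"]) auto
  qed
  ultimately have "card (rooted k n) = card (Sigma ?D (cores k))" by (metis card_image)
  also have "\<dots> = (\<Sum>d\<in>?D. card (cores k d))"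
    using assms by (intro card_SigmaI) (auto simp: finite_cores)
  finally show ?thesis .
qed

text \<open>The rooted systems are exactly those missing from the first part of
  \<open>cores\<close>. The second part is disjoint from the first because \<open>{0}\<close> is too
  small to be a component.\<close>

lemma card_cores:
  "card (cores k n) + card (rooted k n) = num_sum_systems (Suc k) n + num_sum_systems k n"
proof -
  have "{0} # Cs \<notin> sum_systems (Suc k) n" for Cs by (simp add: sum_systems_def)
  then have "{Bs \<in> sum_systems (Suc k) n. 1 \<notin> hd Bs} \<inter> (#) {0} ` sum_systems k n = {}"
    by blast
  then have "card (cores k n) = card {Bs \<in> sum_systems (Suc k) n. 1 \<notin> hd Bs} + card (sum_systems k n)"
    by (simp add: cores_def card_Un_disjoint finite_sum_systems card_image)
  moreover have "sum_systems (Suc k) n = {Bs \<in> sum_systems (Suc k) n. 1 \<notin> hd Bs} \<union> rooted k n"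
    by (auto simp: rooted_def)
  then have "card (sum_systems (Suc k) n) =
      card {Bs \<in> sum_systems (Suc k) n. 1 \<notin> hd Bs} + card (rooted k n)"
    by (subst card_Un_disjoint[symmetric]) (auto simp: rooted_def finite_sum_systems)
  ultimately show ?thesis by (simp add: num_sum_systems_eq_card)
qed

section \<open>The position of the component containing \<open>1\<close>\<close>

lemma sum_systems_mset:
  assumes "As \<in> sum_systems k n" "mset Bs = mset As"
  shows "Bs \<in> sum_systems k n"
proof -
  have "prod_list (map card Bs) = prod_list (map card As)" "sum_list Bs = sum_list As"
       "set Bs = set As" "length Bs = length As"
    using assms(2) by (metis mset_map prod_mset_prod_list, metis sum_mset_sum_list,
        metis set_mset_mset, metis size_mset)
  with assms(1) show ?thesis by (simp add: sum_systems_def)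
qed

text \<open>Existence: a sum of naturals equal to \<open>1\<close> has a summand \<open>1\<close>.
  Uniqueness: if two components contain \<open>1\<close>, then with one of them at the front,
  \<open>1 + 0\<close> and \<open>0 + 1\<close> violate injectivity.\<close>

lemma sum_system_one_unique:
  assumes As: "As \<in> sum_systems k n" and "2 \<le> n"
  shows "\<exists>!j. j < k \<and> 1 \<in> As ! j"
proof -
  have len: "length As = k" using As by (simp add: sum_systems_def)
  have sum: "sum_list As = {0..<n}" "prod_list (map card As) = n" using As by (auto simp: sum_systems_def)
  have ex: "\<exists>B\<in>set Bs. 1 \<in> B" if "(1::nat) \<in> sum_list Bs" for Bs
    using that
  proof (induction Bs)
    case (Cons B Bs)
    then obtain b c where "b \<in> B" "c \<in> sum_list Bs" "1 = b + c" by (auto simp: set_plus_def)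
    then show ?case using Cons by (cases b) auto
  qed simp
  have "1 \<in> sum_list As" using sum \<open>2 \<le> n\<close> by simp
  then have "\<exists>j<k. 1 \<in> As ! j" using ex len by (metis in_set_conv_nth)
  moreover have False if ij: "i < j" "j < k" "1 \<in> As ! i" "1 \<in> As ! j" for i j
  proof -
    define Rs where "Rs = take i As @ drop (Suc i) As"
    have decomp: "As = take i As @ As ! i # drop (Suc i) As"
      using ij len by (simp add: id_take_nth_drop)
    then have "mset As = mset (As ! i # Rs)" unfolding Rs_def by (metis mset_append mset.simps(2) union_mset_add_mset_right)
    then have sys: "As ! i # Rs \<in> sum_systems k n" using sum_systems_mset[OF As] by metis
    define R where "R = sum_list Rs"
    have AR: "As ! i + R = {0..<n}"
      using sys by (simp add: sum_systems_def R_def)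
    have inj: "inj_on (\<lambda>(a, r). a + r) (As ! i \<times> R)"
      unfolding R_def by (rule sum_system_Cons_inj_on[OF sys]) (use \<open>2 \<le> n\<close> in simp)
    have "0 \<in> As ! i + R" using AR \<open>2 \<le> n\<close> by simp
    then have 0: "0 \<in> As ! i" "0 \<in> R" by (auto simp: set_plus_def)
    have "As ! j \<in> set (drop (Suc i) As)"
      using ij len by (auto simp: in_set_conv_nth intro!: exI[of _ "j - Suc i"])
    then have "As ! j \<subseteq> R" using sum_list_sets_subset[of Rs "As ! j"] 0 by (simp add: Rs_def R_def)
    then show False using inj_onD[OF inj, of "(1, 0)" "(0, 1)"] ij 0 by auto
  qed
  ultimately show ?thesis by (metis linorder_neqE_nat)
qed

text \<open>Rotating by \<open>j\<close> brings position \<open>j\<close> to the front and permutes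
  the systems; rotating by \<open>Suc k - j\<close> completes a full turn and undoes it.\<close>

lemma card_one_mem_nth:
  assumes "j < Suc k"
  shows "card {As \<in> sum_systems (Suc k) n. 1 \<in> As ! j} = card (rooted k n)"
proof -
  have len: "length As = Suc k" if "As \<in> sum_systems (Suc k) n" for As
    using that by (simp add: sum_systems_def)
  have rot: "rotate i As \<in> sum_systems (Suc k) n" if "As \<in> sum_systems (Suc k) n" for i As
  proof (rule sum_systems_mset[OF that])
    show "mset (rotate i As) = mset As"
      by (metis append_take_drop_id mset_append rotate_drop_take union_commute)
  qed
  have cycle: "rotate a (rotate b As) = As" if "As \<in> sum_systems (Suc k) n" "a + b = Suc k" for a b As
    using rotate_rotate[of a b As] rotate_id[of "length As" As] len[OF that(1)] that(2) mod_self
    by metis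
  have hd_rot: "hd (rotate j As) = As ! j" if "As \<in> sum_systems (Suc k) n" for As
    using len[OF that] assms hd_rotate_conv_nth[of As j] by force
  have "bij_betw (rotate j) {As \<in> sum_systems (Suc k) n. 1 \<in> As ! j} (rooted k n)"
  proof (rule bij_betw_byWitness[where f' = "rotate (Suc k - j)"])
    show "rotate j ` {As \<in> sum_systems (Suc k) n. 1 \<in> As ! j} \<subseteq> rooted k n"
      using rot hd_rot by (auto simp: rooted_def)
    show "rotate (Suc k - j) ` rooted k n \<subseteq> {As \<in> sum_systems (Suc k) n. 1 \<in> As ! j}"
    proof safe
      fix As assume "As \<in> rooted k n"
      then have As: "As \<in> sum_systems (Suc k) n" "1 \<in> hd As" by (auto simp: rooted_def)
      then show "rotate (Suc k - j) As \<in> sum_systems (Suc k) n" by (intro rot)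
      then have "rotate (Suc k - j) As ! j = hd (rotate j (rotate (Suc k - j) As))"
        by (simp add: hd_rot)
      also have "\<dots> = hd As" using cycle As assms by simp
      finally show "1 \<in> rotate (Suc k - j) As ! j" using As by simp
    qed
  qed (use assms cycle in \<open>auto simp: rooted_def\<close>)
  then show ?thesis by (rule bij_betw_same_card)
qed

lemma num_sum_systems_Suc_1: "num_sum_systems (Suc k) 1 = 0"
proof -
  have "As \<notin> sum_systems (Suc k) 1" for As
  proof
    assume "As \<in> sum_systems (Suc k) 1"
    then show False
      by (cases As) (auto simp: sum_systems_def)
  qed
  then have "sum_systems (Suc k) 1 = {}" by blast
  then show ?thesis by (simp add: num_sum_systems_eq_card)
qed

text \<open>For \<open>n \<ge> 2\<close> the position of \<open>1\<close> partitions the systems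
  into \<open>Suc k\<close> classes of equal size. At \<open>n = 1\<close> there is no
  \<open>1\<close> to locate, but both sides vanish.\<close>

lemma num_sum_systems_eq_rooted:
  assumes "0 < n"
  shows "num_sum_systems (Suc k) n = Suc k * card (rooted k n)"
proof (cases "n = 1")
  case True
  then have "sum_systems (Suc k) n = {}"
    using num_sum_systems_Suc_1[of k] by (simp add: num_sum_systems_eq_card finite_sum_systems)
  then show ?thesis by (simp add: rooted_def num_sum_systems_eq_card)
next
  case False
  then have "2 \<le> n" using assms by simp
  let ?S = "\<lambda>j. {As \<in> sum_systems (Suc k) n. 1 \<in> As ! j}"
  have "sum_systems (Suc k) n = (\<Union>j<Suc k. ?S j)"
    using sum_system_one_unique[OF _ \<open>2 \<le> n\<close>] by blast
  moreover have "card (\<Union>j<Suc k. ?S j) = (\<Sum>j<Suc k. card (?S j))"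
  proof (rule card_UN_disjoint)
    show "\<forall>i\<in>{..<Suc k}. \<forall>j\<in>{..<Suc k}. i \<noteq> j \<longrightarrow> ?S i \<inter> ?S j = {}"
      using sum_system_one_unique[OF _ \<open>2 \<le> n\<close>] by blast
  qed (simp_all add: finite_sum_systems)
  moreover have "(\<Sum>j<Suc k. card (?S j)) = (\<Sum>j<Suc k. card (rooted k n))"
    by (rule sum.cong) (simp_all only: card_one_mem_nth lessThan_iff)
  ultimately show ?thesis by (simp add: num_sum_systems_eq_card)
qed

text \<open>Multiplying \<open>card_cores\<close> by \<open>Suc k\<close> turns the rooted systems
  into one copy of \<open>num_sum_systems (Suc k) d\<close>, which lowers its coefficient from
  \<open>Suc k\<close> to \<open>k\<close>. The case \<open>n = 1\<close>, with an empty sum, is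
  included for the sake of Moebius inversion.\<close>

lemma num_sum_systems_recursion:
  assumes "0 < n"
  shows "int (num_sum_systems (Suc k) n) =
    (\<Sum>d | d dvd n \<and> d < n. int k * int (num_sum_systems (Suc k) d) + int (Suc k) * int (num_sum_systems k d))"
proof -
  have "int (Suc k) * int (card (cores k d)) =
      int k * int (num_sum_systems (Suc k) d) + int (Suc k) * int (num_sum_systems k d)"
    if "d dvd n" for d
  proof -
    have "0 < d" using that assms by (metis dvd_0_left_iff gr0I)
    have "int (card (cores k d)) =
        int (num_sum_systems (Suc k) d) + int (num_sum_systems k d) - int (card (rooted k d))"
      using card_cores[of k d] by linarith
    then show ?thesis
      using num_sum_systems_eq_rooted[OF \<open>0 < d\<close>, of k] by (simp add: algebra_simps)
  qed
  moreover have "int (num_sum_systems (Suc k) n) = (\<Sum>d | d dvd n \<and> d < n. int (Suc k) * int (card (cores k d)))"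
    unfolding num_sum_systems_eq_rooted[OF assms] card_rooted[OF assms]
    by (simp only: of_nat_mult of_nat_sum sum_distrib_left)
  ultimately show ?thesis by simp
qed

section \<open>Moebius inversion over divisors\<close>

lemma moebius_prime_mult:
  assumes "prime p" "\<not> p dvd e"
  shows "moebius (p * e) = - moebius e"
proof -
  have "e \<noteq> 0" using assms(2) by (rule contrapos_nn) simp
  have "coprime p e" using assms by (rule prime_imp_coprime)
  moreover have "squarefree (p * e) \<longleftrightarrow> squarefree e"
    using assms \<open>coprime p e\<close> squarefree_prime squarefree_mult_coprime squarefree_multD(2) by blast
  moreover have "prime_factors (p * e) = insert p (prime_factors e)"
    using assms \<open>e \<noteq> 0\<close> by (auto simp: prime_factors_product prime_factorization_prime)
  moreover have "p \<notin> prime_factors e" using assms by auto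
  ultimately show ?thesis by (simp add: moebius_def)
qed

text \<open>For a fixed prime \<open>p\<close> dividing \<open>n\<close>, the squarefree divisors
  pair up as \<open>e\<close> and \<open>p * e\<close> with \<open>p\<close> not dividing
  \<open>e\<close>, and each pair cancels.\<close>

lemma sum_moebius_divisors:
  assumes "0 < n"
  shows "(\<Sum>d | d dvd n. moebius d) = (if n = 1 then 1 else 0)"
proof (cases "n = 1")
  case True
  then show ?thesis by (simp add: moebius_def)
next
  case False
  then obtain p where p: "prime p" "p dvd n" using prime_factor_nat by blast
  let ?E = "{e. e dvd n \<and> \<not> p dvd e}" and ?F = "{d. d dvd n \<and> p dvd d \<and> squarefree d}"
  have fin: "finite {d. d dvd n}" using assms by simp
  have "(\<Sum>d | d dvd n. moebius d) = (\<Sum>d\<in>?E \<union> {d. d dvd n \<and> p dvd d}. moebius d)"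
    by (rule sum.cong) auto
  also have "\<dots> = (\<Sum>d\<in>?E. moebius d) + (\<Sum>d | d dvd n \<and> p dvd d. moebius d)"
    by (rule sum.union_disjoint) (use fin in auto)
  also have "(\<Sum>d\<in>?E. moebius d) = (\<Sum>d\<in>{e\<in>?E. squarefree e}. moebius d)"
    by (rule sum.mono_neutral_right) (use fin in \<open>auto simp: moebius_def\<close>)
  also have "(\<Sum>d | d dvd n \<and> p dvd d. moebius d) = (\<Sum>d\<in>?F. moebius d)"
    by (rule sum.mono_neutral_right) (use fin in \<open>auto simp: moebius_def\<close>)
  also have "(\<Sum>d\<in>?F. moebius d) = (\<Sum>e\<in>{e\<in>?E. squarefree e}. - moebius e)"
  proof (rule sum.reindex_bij_witness[of _ "\<lambda>e. p * e" "\<lambda>d. d div p"])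
    fix d assume d: "d \<in> ?F"
    then obtain e where e: "d = p * e" by blast
    have "\<not> p dvd e"
    proof
      assume "p dvd e"
      then have "p\<^sup>2 dvd d" by (simp add: e power2_eq_square)
      then show False using d p by (metis (mono_tags, lifting) mem_Collect_eq not_prime_unit squarefreeD)
    qed
    then show "d div p \<in> {e \<in> ?E. squarefree e}" "p * (d div p) = d" "- moebius (d div p) = moebius d"
      using d p e moebius_prime_mult[of p e] by (auto dest: squarefree_multD dvd_mult_right)
  next
    fix e assume e: "e \<in> {e \<in> ?E. squarefree e}"
    then have "coprime p e" using p by (auto simp: prime_imp_coprime)
    then show "p * e \<in> ?F" "p * e div p = e"
      using e p by (auto simp: divides_mult squarefree_mult_coprime squarefree_prime)
  qed
  finally show ?thesis using False by (simp add: sum_negf)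
qed

lemma moebius_inversion:
  fixes F :: "nat \<Rightarrow> int"
  assumes "0 < n"
  shows "(\<Sum>d | d dvd n. moebius (n div d) * (\<Sum>e | e dvd d. F e)) = F n"
proof -
  have fin: "finite {d. d dvd n}" using assms by simp
  have "(\<Sum>d | d dvd n. moebius (n div d) * (\<Sum>e | e dvd d. F e)) =
      (\<Sum>d | d dvd n. \<Sum>e | e dvd n \<and> e dvd d. moebius (n div d) * F e)"
    unfolding sum_distrib_left by (intro sum.cong refl) (auto intro: dvd_trans)
  also have "\<dots> = (\<Sum>e | e dvd n. \<Sum>d | d dvd n \<and> e dvd d. moebius (n div d) * F e)"
    using sum.swap_restrict[OF fin fin, of "\<lambda>d e. moebius (n div d) * F e" "\<lambda>d e. e dvd d"] by simp
  also have "\<dots> = (\<Sum>e | e dvd n. if e = n then F n else 0)"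
  proof (rule sum.cong[OF refl], clarify)
    fix e assume "e dvd n"
    then obtain c where c: "n = e * c" by blast
    have "0 < e" "0 < c" using c assms by auto
    \<comment> \<open>The involution \<open>d \<mapsto> n div d\<close> exchanges the divisors of
      \<open>n\<close> that are multiples of \<open>e\<close> with the divisors of
      \<open>c = n div e\<close>.\<close>
    have "(\<Sum>d | d dvd n \<and> e dvd d. moebius (n div d)) = (\<Sum>d | d dvd c. moebius d)"
    proof (rule sum.reindex_bij_witness[of _ "\<lambda>d. n div d" "\<lambda>d. n div d"])
      fix d assume "d \<in> {d. d dvd n \<and> e dvd d}"
      then obtain a b where "d = e * a" "n = d * b" by (auto elim!: dvdE)
      then show "n div d \<in> {d. d dvd c}" "n div (n div d) = d"
        using assms c by (auto simp: mult.assoc)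
    next
      fix d assume "d \<in> {d. d dvd c}"
      then obtain a where "c = d * a" by blast
      then show "n div (n div d) = d" "n div d \<in> {d. d dvd n \<and> e dvd d}"
        using assms c by auto
    qed simp
    then show "(\<Sum>d | d dvd n \<and> e dvd d. moebius (n div d) * F e) = (if e = n then F n else 0)"
      using sum_moebius_divisors[OF \<open>0 < c\<close>] c \<open>0 < e\<close>
      by (cases "c = 1") (simp_all flip: sum_distrib_right)
  qed
  also have "\<dots> = F n" using assms by (simp add: sum.delta)
  finally show ?thesis .
qed

lemma sum_divisors_split:
  fixes g :: "nat \<Rightarrow> 'a :: ab_group_add"
  assumes "0 < (n::nat)"
  shows "(\<Sum>d | d dvd n. g d) = (\<Sum>d | d dvd n \<and> d < n. g d) + g n"
proof -
  have "{d. d dvd n} = insert n {d. d dvd n \<and> d < n}"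
    using assms by (auto dest: dvd_imp_le)
  then show ?thesis using assms by (simp add: add.commute)
qed

text \<open>The proper divisor sum of \<open>g\<close> is its full divisor sum minus
  \<open>g\<close> itself. Inverting the former gives \<open>c * g n\<close>, which cancels the term
  \<open>d = n\<close> of the latter since \<open>moebius 1 = 1\<close>.\<close>

lemma moebius_inversion_proper:
  fixes F g :: "nat \<Rightarrow> int"
  assumes "0 < n"
    and F: "\<And>d. 0 < d \<Longrightarrow> (\<Sum>e | e dvd d. F e) = c * (\<Sum>e | e dvd d \<and> e < d. g e)"
  shows "F n = - c * (\<Sum>d | d dvd n \<and> d < n. moebius (n div d) * g d)"
proof -
  have "F n = (\<Sum>d | d dvd n. moebius (n div d) * (\<Sum>e | e dvd d. F e))"
    using moebius_inversion[OF \<open>0 < n\<close>] by simp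
  also have "\<dots> = (\<Sum>d | d dvd n. c * (moebius (n div d) * (\<Sum>e | e dvd d. g e)) - c * (moebius (n div d) * g d))"
  proof (rule sum.cong[OF refl], clarify)
    fix d assume "d dvd n"
    then have "0 < d" using assms by (metis dvd_0_left_iff gr0I)
    show "moebius (n div d) * (\<Sum>e | e dvd d. F e) =
        c * (moebius (n div d) * (\<Sum>e | e dvd d. g e)) - c * (moebius (n div d) * g d)"
      unfolding F[OF \<open>0 < d\<close>] sum_divisors_split[OF \<open>0 < d\<close>, of g] by (simp add: algebra_simps)
  qed
  also have "\<dots> = c * g n - c * (\<Sum>d | d dvd n. moebius (n div d) * g d)"
    by (simp add: sum_subtractf moebius_inversion[OF \<open>0 < n\<close>] flip: sum_distrib_left)
  also have "\<dots> = - c * (\<Sum>d | d dvd n \<and> d < n. moebius (n div d) * g d)"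
    using assms by (simp add: sum_divisors_split moebius_def algebra_simps)
  finally show ?thesis .
qed

theorem theorem4p2:
  fixes m N :: nat
  assumes "1 \<le> m" and "2 \<le> N"
  shows
    "int (num_sum_systems m N) =
       (\<Sum>d | d dvd N \<and> d < N.
          (int m - 1) * int (num_sum_systems m d) + int m * int (num_sum_systems (m - 1) d))
     \<and>
     int (num_sum_systems m N) =
       - int m * (\<Sum>d | d dvd N \<and> d < N.
          moebius (N div d) * (int (num_sum_systems m d) + int (num_sum_systems (m - 1) d)))
     \<and>
     num_unordered_sum_systems m N =
       (\<Sum>d | d dvd N \<and> d < N.
          (of_nat m - 1) * num_unordered_sum_systems m d + num_unordered_sum_systems (m - 1) d)
     \<and>
     num_unordered_sum_systems m N =
       - (\<Sum>d | d dvd N \<and> d < N.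
          of_int (moebius (N div d)) *
            (of_nat m * num_unordered_sum_systems m d + num_unordered_sum_systems (m - 1) d))"
proof -
  obtain k where m: "m = Suc k" using assms(1) by (cases m) auto
  have "0 < N" using assms(2) by simp
  let ?N = "\<lambda>k n. rat_of_nat (num_sum_systems k n)"
  have rec: "int (num_sum_systems m n) = (\<Sum>d | d dvd n \<and> d < n.
          (int m - 1) * int (num_sum_systems m d) + int m * int (num_sum_systems (m - 1) d))"
    if "0 < n" for n
    using num_sum_systems_recursion[OF that, of k] by (simp add: m)
  have moeb: "int (num_sum_systems m N) = - int m * (\<Sum>d | d dvd N \<and> d < N.
          moebius (N div d) * (int (num_sum_systems m d) + int (num_sum_systems (m - 1) d)))"
  \<comment> \<open>Adding the term \<open>e = d\<close> to the recursion raises the coefficient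
    \<open>m - 1\<close> to \<open>m\<close>, so \<open>m\<close> factors out as the constant
    \<open>c\<close>.\<close>
  proof (rule moebius_inversion_proper[OF \<open>0 < N\<close>])
    fix d :: nat assume "0 < d"
    then show "(\<Sum>e | e dvd d. int (num_sum_systems m e)) =
        int m * (\<Sum>e | e dvd d \<and> e < d. int (num_sum_systems m e) + int (num_sum_systems (m - 1) e))"
      by (simp add: sum_divisors_split rec[OF \<open>0 < d\<close>] sum_distrib_left algebra_simps flip: sum.distrib)
  qed
  \<comment> \<open>Since \<open>1 / fact (m - 1) = m / fact m\<close>, both counts get the
    denominator \<open>fact m\<close>, and the ordered recursions can be divided by it
    termwise.\<close>
  have M: "num_unordered_sum_systems m n = ?N m n / fact m"
    "num_unordered_sum_systems (m - 1) n = of_nat m * ?N (m - 1) n / fact m" for n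
    by (simp_all add: num_unordered_sum_systems_def m del: of_nat_Suc)
  have "?N m N = of_int (int (num_sum_systems m N))" by simp
  also have "\<dots> = (\<Sum>d | d dvd N \<and> d < N. (of_nat m - 1) * ?N m d + of_nat m * ?N (m - 1) d)"
    by (subst rec[OF \<open>0 < N\<close>]) simp
  finally have rec': "num_unordered_sum_systems m N = (\<Sum>d | d dvd N \<and> d < N.
          (of_nat m - 1) * num_unordered_sum_systems m d + num_unordered_sum_systems (m - 1) d)"
    unfolding M by (simp add: sum_divide_distrib add_divide_distrib)
  have "?N m N = of_int (int (num_sum_systems m N))" by simp
  also have "\<dots> = - (\<Sum>d | d dvd N \<and> d < N.
        of_int (moebius (N div d)) * (of_nat m * ?N m d + of_nat m * ?N (m - 1) d))"
    by (subst moeb) (simp add: sum_distrib_left algebra_simps flip: sum_negf)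
  finally have moeb': "num_unordered_sum_systems m N = - (\<Sum>d | d dvd N \<and> d < N.
          of_int (moebius (N div d)) *
            (of_nat m * num_unordered_sum_systems m d + num_unordered_sum_systems (m - 1) d))"
    unfolding M by (simp add: sum_divide_distrib add_divide_distrib distrib_left)
  show ?thesis using rec[OF \<open>0 < N\<close>] moeb rec' moeb' by blast
qed

end
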